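(* Let $a\in\mathbb{R}$, $\alpha\in(0,1)$, $\mu<0$, $\gamma\in\mathbb{R}$, and let $w:\mathbb{N}_a\to\mathbb{R}\setminus\{0\}$ satisfy $\frac{w(a)}{w(k)}>0$ for all $k\in\mathbb{N}_{a+1}$. Let $x,y:\mathbb{N}_a\to\mathbb{R}$ satisfy $x(a)=y(a)$ and, for all $k\in\mathbb{N}_{a+1}$, $${}_a^{\rm C}\nabla_k^{\alpha,w(k)}x(k)\ge \mu x(k)+\gamma,\qquad {}_a^{\rm C}\nabla_k^{\alpha,w(k)}y(k)\le \mu y(k)+\gamma.$$ Then $x(k)\ge y(k)$ for all $k\in\mathbb{N}_{a+1}$.
   Context: For $a\in\mathbb{R}$, $\mathbb{N}_a:=\{a,a+1,a+2,\dots\}$. The nabla difference is $\nabla x(k):=x(k)-x(k-1)$. For $\beta\in(-1,1)$ and $k\in\mathbb{N}_{a+1}$, the Grünwald–Letnikov difference/sum is $${}_a^{\rm G}\nabla_k^{\beta}x(k):=\sum_{i=0}^{k-a-1}(-1)^i\binom{\beta}{i}x(k-i),\qquad \binom{p}{q}:=\frac{\Gamma(p+1)}{\Gamma(q+1)\Gamma(p-q+1)}.$$ For $\alpha\in(0,1)$ and $k\in\mathbb{N}_{a+1}$, the Caputo difference is ${}_a^{\rm C}\nabla_k^{\alpha}x(k):={}_a^{\rm G}\nabla_k^{\alpha-1}\nabla x(k)$. Given a tempered function $w$, the Caputo tempered difference is ${}_a^{\rm C}\nabla_k^{\alpha,w(k)}x(k):=w^{-1}(k)\,{}_a^{\rm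 C}\nabla_k^{\alpha}[w(k)x(k)]$, where $w^{-1}(k)=1/w(k)$. *)

theory Defs
  imports "HOL-Analysis.Analysis"
begin

(* Functions on the grid {a, a+1, ...} are represented by total functions real => real;
   the operators below, applied at grid points k >= a + 1, only read values at grid points. *)

definition grid :: "real \<Rightarrow> real set" where
  "grid a = range (\<lambda>n::nat. a + real n)"

definition nabla :: "(real \<Rightarrow> real) \<Rightarrow> real \<Rightarrow> real" where
  "nabla x k = x k - x (k - 1)"

(* For p > -1 and q a natural number only Gamma (p - q + 1) can sit at a pole; there the
   conventions Gamma = 0 and division by zero = 0 give 0, agreeing with the usual 1/Gamma = 0. *)
definition binom_Gamma :: "real \<Rightarrow> real \<Rightarrow> real" where
  "binom_Gamma p q = Gamma (p + 1) / (Gamma (q + 1) * Gamma (p - q + 1))"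

definition GL_nabla :: "real \<Rightarrow> real \<Rightarrow> (real \<Rightarrow> real) \<Rightarrow> real \<Rightarrow> real" where
  "GL_nabla a \<beta> x k =
     (\<Sum>i\<in>{i::nat. real i \<le> k - a - 1}. (-1) ^ i * binom_Gamma \<beta> (real i) * x (k - real i))"

definition Caputo_nabla :: "real \<Rightarrow> real \<Rightarrow> (real \<Rightarrow> real) \<Rightarrow> real \<Rightarrow> real" where
  "Caputo_nabla a \<alpha> x k = GL_nabla a (\<alpha> - 1) (nabla x) k"

definition Caputo_tempered_nabla ::
  "real \<Rightarrow> real \<Rightarrow> (real \<Rightarrow> real) \<Rightarrow> (real \<Rightarrow> real) \<Rightarrow> real \<Rightarrow> real" where
  "Caputo_tempered_nabla a \<alpha> w x k = 1 / w k * Caputo_nabla a \<alpha> (\<lambda>j. w j * x j) k"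

end

theory Submission
  imports Defs
begin

text \<open>
  The comparison principle is a discrete maximum principle. Write \<open>c i = (-1)^i * (\<beta> choose i)\<close>
  with \<open>\<beta> = \<alpha> - 1\<close>. On the grid the Caputo difference of \<open>v\<close> is the convolution of \<open>c\<close> with the
  increments of \<open>v\<close>. Summation by parts moves the differences onto the weights:
  the value of \<open>v\<close> at the current point gets the weight \<open>c 0\<close>, every earlier value gets
  \<open>c (i + 1) - c i\<close>, and the initial value gets \<open>- c m\<close>. Because \<open>-1 < \<beta> < 0\<close>, the ratio
  \<open>(i - \<beta>) / (i + 1)\<close> of consecutive weights lies in \<open>(0, 1)\<close>, so \<open>c\<close> is positive and
  decreasing, and the whole past enters with nonpositive weights. Hence, if the Caputo difference
  of \<open>v\<close> dominates \<open>\<mu> * v\<close> with \<open>\<mu> < 0\<close>, and \<open>v\<close> has been nonnegative so far, then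
  \<open>(c 0 - \<mu>) * v\<close> is bounded below at the current point by a nonnegative combination of the past
  (\<open>nonneg_if_convolved_increments_ge\<close>); strong induction propagates the sign.

  This is applied to \<open>v n = w (a + n) / w a * (x (a + n) - y (a + n))\<close>. The two inequalities
  are subtracted, which removes \<open>\<gamma>\<close>, and multiplied by \<open>w k / w a > 0\<close>, which removes
  the tempering; the sign condition on \<open>w\<close> also makes the signs of \<open>v\<close> and \<open>x - y\<close> agree.
\<close>

section \<open>A maximum principle for convolved increments\<close>

text \<open>Summation by parts: each \<open>v (m - i)\<close> with \<open>i < m\<close> occurs in two consecutive
  increments, with the weights \<open>c (i + 1)\<close> and \<open>- c i\<close>.\<close>

lemma convolved_increments_by_parts:
  fixes c v :: "nat \<Rightarrow> 'a::comm_ring_1"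
  shows "(\<Sum>i\<le>m. c i * (v (Suc m - i) - v (m - i))) =
    c 0 * v (Suc m) - (\<Sum>i<m. (c i - c (Suc i)) * v (m - i)) - c m * v 0"
proof -
  have "(\<Sum>i\<le>m. c i * v (Suc m - i)) = c 0 * v (Suc m) + (\<Sum>i<m. c (Suc i) * v (m - i))"
    by (simp flip: lessThan_Suc_atMost add: sum.lessThan_Suc_shift del: sum.lessThan_Suc)
  moreover have "(\<Sum>i\<le>m. c i * v (m - i)) = (\<Sum>i<m. c i * v (m - i)) + c m * v 0"
    by (simp flip: lessThan_Suc_atMost)
  ultimately show ?thesis
    by (simp add: algebra_simps sum_subtractf)
qed

lemma nonneg_if_convolved_increments_ge:
  fixes c v :: "nat \<Rightarrow> real"
  assumes c_nonneg: "\<And>i. 0 \<le> c i" and c_dec: "\<And>i. c (Suc i) \<le> c i" and "\<mu> < c 0"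
    and "0 \<le> v 0"
    and ge: "\<And>m. \<mu> * v (Suc m) \<le> (\<Sum>i\<le>m. c i * (v (Suc m - i) - v (m - i)))"
  shows "0 \<le> v n"
proof (induction n rule: less_induct)
  case (less n)
  show ?case
  proof (cases n)
    case 0
    with \<open>0 \<le> v 0\<close> show ?thesis by simp
  next
    case (Suc m)
    have "0 \<le> (\<Sum>i<m. (c i - c (Suc i)) * v (m - i)) + c m * v 0"
      using c_nonneg c_dec \<open>0 \<le> v 0\<close> less.IH Suc
      by (intro add_nonneg_nonneg sum_nonneg mult_nonneg_nonneg) auto
    also have "\<dots> \<le> (c 0 - \<mu>) * v n"
      using ge[of m] Suc unfolding convolved_increments_by_parts by (simp add: left_diff_distrib)
    finally show ?thesis
      using \<open>\<mu> < c 0\<close> by (simp add: zero_le_mult_iff)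
  qed
qed

section \<open>The weights of the Caputo difference\<close>

text \<open>For \<open>-1 < \<beta> < 0\<close> no \<open>\<beta> - i\<close> is an integer, so Gamma is only evaluated away from its
  poles, and its functional equation yields the usual recurrence of binomial coefficients
  without exceptional cases.\<close>

lemma binom_Gamma_Suc:
  assumes "-1 < \<beta>" "\<beta> < 0"
  shows "binom_Gamma \<beta> (real (Suc i)) = binom_Gamma \<beta> (real i) * ((\<beta> - real i) / (real i + 1))"
proof -
  have nonint: "\<beta> - real i \<notin> \<int>"
  proof
    assume "\<beta> - real i \<in> \<int>"
    then have "\<beta> \<in> \<int>"
      using Ints_add[of "\<beta> - real i" "real i"] by simp
    with assms show False by (auto elim!: Ints_cases)
  qed
  have pos_not_nonpos: "real i + 1 \<notin> \<int>\<^sub>\<le>\<^sub>0"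
    using nonpos_Ints_nonpos[of "real i + 1"] by auto
  from nonint have nonpos: "\<beta> - real i \<notin> \<int>\<^sub>\<le>\<^sub>0" by auto
  have "Gamma (\<beta> - real i + 1) = (\<beta> - real i) * Gamma (\<beta> - real i)"
    using nonpos by (rule Gamma_plus1)
  moreover have "Gamma (real (Suc i) + 1) = (real i + 1) * Gamma (real i + 1)"
    using Gamma_plus1[of "real i + 1"] pos_not_nonpos by (simp add: add_ac)
  moreover have "\<beta> - real (Suc i) + 1 = \<beta> - real i" by simp
  moreover have "\<beta> - real i \<noteq> 0" using nonint by auto
  ultimately show ?thesis
    unfolding binom_Gamma_def by simp
qed

lemma binom_Gamma_0:
  assumes "-1 < \<beta>"
  shows "binom_Gamma \<beta> 0 = 1"
proof -
  have "Gamma (\<beta> + 1) > 0"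
    using assms by (intro Gamma_real_pos) simp
  then have "Gamma (\<beta> + 1) \<noteq> 0" by (rule less_imp_neq[symmetric])
  then show ?thesis by (simp add: binom_Gamma_def)
qed

lemma GL_weight_Suc:
  assumes "-1 < \<beta>" "\<beta> < 0"
  shows "(-1) ^ Suc i * binom_Gamma \<beta> (real (Suc i)) =
    (-1) ^ i * binom_Gamma \<beta> (real i) * ((real i - \<beta>) / (real i + 1))"
  unfolding binom_Gamma_Suc[OF assms] by (simp add: field_simps)

lemma GL_weight_pos:
  assumes "-1 < \<beta>" "\<beta> < 0"
  shows "0 < (-1) ^ i * binom_Gamma \<beta> (real i)"
proof (induction i)
  case 0
  show ?case using assms by (simp add: binom_Gamma_0)
next
  case (Suc i)
  then show ?case
    unfolding GL_weight_Suc[OF assms] by (rule mult_pos_pos) (use assms in auto)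
qed

lemma GL_weight_decreasing:
  assumes "-1 < \<beta>" "\<beta> < 0"
  shows "(-1) ^ Suc i * binom_Gamma \<beta> (real (Suc i)) \<le> (-1) ^ i * binom_Gamma \<beta> (real i)"
  unfolding GL_weight_Suc[OF assms]
  using assms by (intro mult_left_le[OF _ less_imp_le[OF GL_weight_pos[OF assms]]]) auto

text \<open>Reindexing the real grid by the natural numbers turns the Caputo difference into a
  convolution of sequences.\<close>

lemma Caputo_nabla_grid:
  "Caputo_nabla a \<alpha> f (a + real (Suc m)) =
    (\<Sum>i\<le>m. (-1) ^ i * binom_Gamma (\<alpha> - 1) (real i) *
      (f (a + real (Suc m - i)) - f (a + real (m - i))))"
proof -
  have "{i. real i \<le> a + real (Suc m) - a - 1} = {..m}" by auto
  then show ?thesis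
    unfolding Caputo_nabla_def GL_nabla_def nabla_def
    by (auto intro!: sum.cong simp: of_nat_diff algebra_simps)
qed

section \<open>The comparison principle\<close>

theorem theorem3p4:
  fixes a \<alpha> \<mu> \<gamma> :: real and w x y :: "real \<Rightarrow> real"
  assumes "0 < \<alpha>" and "\<alpha> < 1" and "\<mu> < 0"
    and "\<And>k. k \<in> grid a \<Longrightarrow> w k \<noteq> 0"
    and "\<And>k. k \<in> grid (a + 1) \<Longrightarrow> w a / w k > 0"
    and "x a = y a"
    and "\<And>k. k \<in> grid (a + 1) \<Longrightarrow> Caputo_tempered_nabla a \<alpha> w x k \<ge> \<mu> * x k + \<gamma>"
    and "\<And>k. k \<in> grid (a + 1) \<Longrightarrow> Caputo_tempered_nabla a \<alpha> w y k \<le> \<mu> * y k + \<gamma>"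
  shows "\<forall>k \<in> grid (a + 1). x k \<ge> y k"
proof -
  define c where "c i = (-1) ^ i * binom_Gamma (\<alpha> - 1) (real i)" for i :: nat
  define v where "v n = w (a + real n) / w a * (x (a + real n) - y (a + real n))" for n
  have grid: "a + real (Suc m) \<in> grid (a + 1)" for m
    by (auto simp: grid_def)
  have w_ratio_pos: "0 < w (a + real (Suc m)) / w a" for m
    using assms(5)[OF grid[of m]] by (auto simp: zero_less_divide_iff)
  have v_ge: "\<mu> * v (Suc m) \<le> (\<Sum>i\<le>m. c i * (v (Suc m - i) - v (m - i)))" for m
  proof -
    define k where "k = a + real (Suc m)"
    have r: "0 < w k / w a" using w_ratio_pos[of m] by (simp add: k_def)
    then have nz: "w k \<noteq> 0" "w a \<noteq> 0" by auto
    have "\<mu> * (x k - y k) \<le> Caputo_tempered_nabla a \<alpha> w x k - Caputo_tempered_nabla a \<alpha> w y k"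
      using assms(7,8)[OF grid[of m]] by (simp add: k_def algebra_simps)
    then have "w k / w a * (\<mu> * (x k - y k)) \<le>
      w k / w a * (Caputo_tempered_nabla a \<alpha> w x k - Caputo_tempered_nabla a \<alpha> w y k)"
      using r by (intro mult_left_mono) auto
    also have "\<dots> = (Caputo_nabla a \<alpha> (\<lambda>j. w j * x j) k - Caputo_nabla a \<alpha> (\<lambda>j. w j * y j) k) / w a"
      using nz by (simp add: Caputo_tempered_nabla_def field_simps)
    also have "\<dots> = (\<Sum>i\<le>m. c i * (v (Suc m - i) - v (m - i)))"
      unfolding k_def Caputo_nabla_grid sum_subtractf[symmetric] sum_divide_distrib
      using nz by (intro sum.cong) (auto simp: c_def v_def field_simps)
    finally show ?thesis by (simp add: v_def k_def mult_ac)
  qed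
  have "0 \<le> v n" for n
  proof (rule nonneg_if_convolved_increments_ge[OF _ _ _ _ v_ge])
    show "0 \<le> c i" "c (Suc i) \<le> c i" for i
      using GL_weight_pos[of "\<alpha> - 1" i] GL_weight_decreasing[of "\<alpha> - 1" i] assms(1,2)
      unfolding c_def by auto
    show "\<mu> < c 0" using assms(1,3) by (simp add: c_def binom_Gamma_0)
    show "0 \<le> v 0" using assms(6) by (simp add: v_def)
  qed
  then have "y (a + real (Suc m)) \<le> x (a + real (Suc m))" for m
    using w_ratio_pos[of m] unfolding v_def by (metis diff_ge_0_iff_ge zero_le_mult_iff not_less)
  then show ?thesis
    by (auto simp: grid_def add_ac)
qed

end
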